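(* Let $S_n=(S_n^x,S_n^y)$, $n\ge 0$, be the simple random walk on the 2-dimensional comb $\mathbf C_2$ started at $S_0=(0,0)$. Then $$\mathbb E[|S_n^y|]\sim\sqrt{\frac{2}{\pi}}\,n^{1/2}\qquad (n\to\infty).$$
   Context: The 2-dimensional comb $\mathbf C_2$ is the graph with vertex set $\mathbb Z^2$ obtained from the usual square lattice by removing all horizontal edges off the $x$-axis: $(x,y)$ is adjacent to $(x,y\pm1)$ for all $x,y\in\mathbb Z$, and $(x,0)$ is adjacent to $(x\pm1,0)$ for all $x\in\mathbb Z$. The simple random walk moves at each step to a uniformly chosen neighbour of the current vertex (transition probabilities $1/4$ from vertices on the $x$-axis and $1/2$ from other vertices). $a_n\sim b_n$ means $a_n/b_n\to1$. *)

theory Defs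
  imports "HOL-Probability.Probability" "HOL-Library.Landau_Symbols"
begin

definition comb_adj :: "int \<times> int \<Rightarrow> int \<times> int \<Rightarrow> bool" where
  "comb_adj v w \<longleftrightarrow>
     (fst v = fst w \<and> \<bar>snd v - snd w\<bar> = 1) \<or>
     (snd v = 0 \<and> snd w = 0 \<and> \<bar>fst v - fst w\<bar> = 1)"

(* One step of the simple random walk; meaningful if v has a finite, nonzero number of neighbours. *)
definition srw_step :: "('v \<Rightarrow> 'v \<Rightarrow> bool) \<Rightarrow> 'v \<Rightarrow> 'v pmf" where
  "srw_step adj v = pmf_of_set {w. adj v w}"

(* The Markov property is stated as the product formula for the probabilities of finite paths;
   this avoids conditioning on null events. *)
definition simple_random_walk ::
    "('v \<Rightarrow> 'v \<Rightarrow> bool) \<Rightarrow> 'v \<Rightarrow> 'a measure \<Rightarrow> (nat \<Rightarrow> 'a \<Rightarrow> 'v) \<Rightarrow> bool" where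
  "simple_random_walk adj v0 M S \<longleftrightarrow>
     prob_space M \<and>
     (\<forall>n. S n \<in> measurable M (count_space UNIV)) \<and>
     (AE \<omega> in M. S 0 \<omega> = v0) \<and>
     (\<forall>n s. measure M {\<omega> \<in> space M. \<forall>i\<le>Suc n. S i \<omega> = s i} =
            measure M {\<omega> \<in> space M. \<forall>i\<le>n. S i \<omega> = s i} * pmf (srw_step adj (s n)) (s (Suc n)))"

lemma comb_neighbours:
  "{w. comb_adj (x, y) w} =
     (if y = 0 then {(x, 1), (x, -1), (x + 1, 0), (x - 1, 0)} else {(x, y + 1), (x, y - 1)})"
  by (auto simp: comb_adj_def)

lemma pmf_comb_step:
  "pmf (srw_step comb_adj v) w =
     (if comb_adj v w then if snd v = 0 then 1 / 4 else 1 / 2 else 0)"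
proof (cases v)
  case (Pair x y)
  have fin: "finite {w. comb_adj (x, y) w}" and ne: "{w. comb_adj (x, y) w} \<noteq> {}"
    unfolding comb_neighbours by auto
  have card: "card {w. comb_adj (x, y) w} = (if y = 0 then 4 else 2)"
    unfolding comb_neighbours by auto
  show ?thesis
    unfolding srw_step_def Pair by (auto simp: pmf_of_set[OF ne fin] card indicator_def)
qed

end

theory Submission
  imports Defs "HOL-Real_Asymp.Real_Asymp"
begin

text \<open>
  The height \<open>\<bar>S\<^sub>n\<^sup>y\<bar>\<close> is itself a Markov chain on the natural numbers. From \<open>k > 0\<close> it moves to
  \<open>k - 1\<close> or \<open>k + 1\<close> with probability \<open>1/2\<close> each; on the \<open>x\<close>-axis two of the four neighbours have
  height \<open>1\<close> and the other two have height \<open>0\<close>, so it moves to \<open>1\<close> or stays at \<open>0\<close> with probability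
  \<open>1/2\<close> each. This chain is the simple random walk on the integers folded by \<open>z \<mapsto> max z (- 1 - z)\<close>,
  which gives its exact law: \<open>P(\<bar>S\<^sub>n\<^sup>y\<bar> = k) = (n choose \<lceil>(n + k) / 2\<rceil>) / 2\<^sup>n\<close> (\<open>height_law\<close>).

  The mean height has no drift except at \<open>0\<close>, where one step adds \<open>1/2\<close> on average. It therefore
  grows at step \<open>n + 1\<close> by half the probability of height \<open>0\<close> at time \<open>n\<close>, and these increments sum
  to a closed form in the return probabilities \<open>(2 m choose m) / 4\<^sup>m\<close>
  (\<open>mean_height_closed_form\<close>). Wallis' product says that
  \<open>(2 m + 1) ((2 m choose m) / 4\<^sup>m)\<^sup>2\<close> tends to \<open>2/\<pi>\<close> (\<open>central_prob_asymptotics\<close>), and the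
  asymptotics of the mean follow along even and along odd times.
\<close>

section \<open>One-dimensional laws of a simple random walk\<close>

text \<open>
  The walk is given by the probabilities of finite paths. Summing the product formula over the
  countably many paths of length \<open>n\<close> that end in \<open>v\<close> leaves the joint law of two successive positions.
\<close>

lemma simple_random_walk_transition:
  fixes S :: "nat \<Rightarrow> 'a \<Rightarrow> 'v :: countable"
  assumes "simple_random_walk adj v0 M S"
  shows "emeasure M {\<omega> \<in> space M. S n \<omega> = v \<and> S (Suc n) \<omega> = w} =
           emeasure M {\<omega> \<in> space M. S n \<omega> = v} * pmf (srw_step adj v) w"
proof -
  interpret prob_space M
    using assms by (simp add: simple_random_walk_def)
  have [measurable]: "S i \<in> measurable M (count_space UNIV)" for i
    using assms by (simp add: simple_random_walk_def)
  \<comment> \<open>A path of length \<open>n\<close> is a list: functions on all of \<open>nat\<close> would be uncountably many.\<close>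
  define L where "L = {l :: 'v list. length l = Suc n \<and> l ! n = v}"
  define A where "A l = {\<omega> \<in> space M. \<forall>i\<le>n. S i \<omega> = l ! i}" for l :: "'v list"
  define B where "B l = {\<omega> \<in> space M. \<forall>i\<le>Suc n. S i \<omega> = (l @ [w]) ! i}" for l :: "'v list"
  have sets: "A l \<in> sets M" "B l \<in> sets M" for l
    unfolding A_def B_def by measurable
  have B_eq: "B l = {\<omega> \<in> A l. S (Suc n) \<omega> = w}" if "l \<in> L" for l
    using that by (auto simp: A_def B_def L_def nth_append le_Suc_eq all_conj_distrib)
  have step: "emeasure M (B l) = emeasure M (A l) * pmf (srw_step adj v) w" if l: "l \<in> L" for l
  proof -
    have "measure M (B l) = measure M {\<omega> \<in> space M. \<forall>i\<le>n. S i \<omega> = (l @ [w]) ! i} *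
            pmf (srw_step adj ((l @ [w]) ! n)) ((l @ [w]) ! Suc n)"
      using assms unfolding B_def simple_random_walk_def by blast
    also have "{\<omega> \<in> space M. \<forall>i\<le>n. S i \<omega> = (l @ [w]) ! i} = A l"
      using l by (auto simp: A_def L_def nth_append)
    finally show ?thesis
      using l by (simp add: L_def nth_append emeasure_eq_measure ennreal_mult)
  qed
  have disj: "disjoint_family_on A L" "disjoint_family_on B L"
  proof -
    have "l = l'" if "l \<in> L" "l' \<in> L" "\<omega> \<in> A l" "\<omega> \<in> A l'" for l l' \<omega>
      using that by (intro nth_equalityI) (auto simp: A_def L_def less_Suc_eq_le)
    then show "disjoint_family_on A L" "disjoint_family_on B L"
      using B_eq unfolding disjoint_family_on_def by blast+
  qed
  have UN_A: "(\<Union>l\<in>L. A l) = {\<omega> \<in> space M. S n \<omega> = v}"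
  proof (intro equalityI subsetI)
    fix \<omega> assume "\<omega> \<in> {\<omega> \<in> space M. S n \<omega> = v}"
    then have "map (\<lambda>i. S i \<omega>) [0..<Suc n] \<in> L" "\<omega> \<in> A (map (\<lambda>i. S i \<omega>) [0..<Suc n])"
      by (auto simp: L_def A_def simp del: upt_Suc)
    then show "\<omega> \<in> (\<Union>l\<in>L. A l)" by blast
  qed (auto simp: L_def A_def)
  have UN_B: "(\<Union>l\<in>L. B l) = {\<omega> \<in> space M. S n \<omega> = v \<and> S (Suc n) \<omega> = w}"
    using UN_A B_eq by blast
  have "emeasure M (\<Union>l\<in>L. B l) = (\<integral>\<^sup>+l. emeasure M (B l) \<partial>count_space L)"
    by (intro emeasure_UN_countable sets disj) simp_all
  also have "\<dots> = (\<integral>\<^sup>+l. emeasure M (A l) * pmf (srw_step adj v) w \<partial>count_space L)"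
    by (intro nn_integral_cong) (simp add: step)
  also have "\<dots> = (\<integral>\<^sup>+l. emeasure M (A l) \<partial>count_space L) * pmf (srw_step adj v) w"
    by (intro nn_integral_multc) simp
  also have "(\<integral>\<^sup>+l. emeasure M (A l) \<partial>count_space L) = emeasure M (\<Union>l\<in>L. A l)"
    by (intro emeasure_UN_countable [symmetric] sets disj) simp_all
  finally show ?thesis
    by (simp only: UN_A UN_B)
qed

primrec srw_law :: "('v \<Rightarrow> 'v \<Rightarrow> bool) \<Rightarrow> 'v \<Rightarrow> nat \<Rightarrow> 'v pmf" where
  "srw_law adj v0 0 = return_pmf v0"
| "srw_law adj v0 (Suc n) = srw_law adj v0 n \<bind> srw_step adj"

lemma simple_random_walk_distr:
  fixes S :: "nat \<Rightarrow> 'a \<Rightarrow> 'v :: countable"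
  assumes "simple_random_walk adj v0 M S"
  shows "distr M (count_space UNIV) (S n) = measure_pmf (srw_law adj v0 n)"
proof -
  interpret prob_space M
    using assms by (simp add: simple_random_walk_def)
  have [measurable]: "S i \<in> measurable M (count_space UNIV)" for i
    using assms by (simp add: simple_random_walk_def)
  have "emeasure M {\<omega> \<in> space M. S n \<omega> = w} = pmf (srw_law adj v0 n) w" for w
  proof (induction n arbitrary: w)
    case 0
    have "AE \<omega> in M. S 0 \<omega> = v0"
      using assms by (simp add: simple_random_walk_def)
    then have "emeasure M {\<omega> \<in> space M. S 0 \<omega> = w} = emeasure M {\<omega> \<in> space M. v0 = w}"
      by (intro emeasure_eq_AE) auto
    then show ?case
      by (auto simp: indicator_def emeasure_space_1)
  next
    case (Suc n)
    have "{\<omega> \<in> space M. S (Suc n) \<omega> = w} =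
            (\<Union>v. {\<omega> \<in> space M. S n \<omega> = v \<and> S (Suc n) \<omega> = w})"
      by blast
    then have "emeasure M {\<omega> \<in> space M. S (Suc n) \<omega> = w} =
        (\<integral>\<^sup>+v. emeasure M {\<omega> \<in> space M. S n \<omega> = v \<and> S (Suc n) \<omega> = w} \<partial>count_space UNIV)"
      by (simp only:) (intro emeasure_UN_countable; auto simp: disjoint_family_on_def)
    also have "\<dots> = (\<integral>\<^sup>+v. ennreal (pmf (srw_law adj v0 n) v) * pmf (srw_step adj v) w
                      \<partial>count_space UNIV)"
      by (simp add: simple_random_walk_transition[OF assms] Suc.IH)
    also have "\<dots> = pmf (srw_law adj v0 (Suc n)) w"
      by (simp add: ennreal_pmf_bind nn_integral_measure_pmf)
    finally show ?case .
  qed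
  then show ?thesis
    by (intro measure_eqI_countable[where A = UNIV])
       (auto simp: emeasure_distr vimage_def Int_def emeasure_pmf_single conj_commute)
qed

lemma simple_random_walk_expectation:
  fixes S :: "nat \<Rightarrow> 'a \<Rightarrow> 'v :: countable" and h :: "'v \<Rightarrow> real"
  assumes "simple_random_walk adj v0 M S"
  shows "prob_space.expectation M (\<lambda>\<omega>. h (S n \<omega>)) = measure_pmf.expectation (srw_law adj v0 n) h"
proof -
  have "S n \<in> measurable M (count_space UNIV)"
    using assms by (simp add: simple_random_walk_def)
  then have "prob_space.expectation M (\<lambda>\<omega>. h (S n \<omega>)) =
      integral\<^sup>L (distr M (count_space UNIV) (S n)) h"
    by (simp add: integral_distr)
  then show ?thesis
    by (simp add: simple_random_walk_distr[OF assms])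
qed

section \<open>The height process of the comb\<close>

abbreviation comb_law :: "nat \<Rightarrow> (int \<times> int) pmf" where
  "comb_law \<equiv> srw_law comb_adj (0, 0)"

definition height :: "int \<times> int \<Rightarrow> nat" where
  "height v = nat \<bar>snd v\<bar>"

text \<open>
  The mean is taken for an arbitrary function of the height, so that one recurrence in \<open>n\<close> yields both
  the law of the height (indicator functions) and its expectation (the embedding \<open>real\<close>).
\<close>

definition height_mean :: "nat \<Rightarrow> (nat \<Rightarrow> real) \<Rightarrow> real" where
  "height_mean n g = measure_pmf.expectation (comb_law n) (\<lambda>v. g (height v))"

lemma finite_comb_neighbours: "finite {w. comb_adj v w}"
  by (cases v) (simp add: comb_neighbours)

lemma comb_neighbours_nonempty: "{w. comb_adj v w} \<noteq> {}"
  by (cases v) (simp add: comb_neighbours)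

lemma set_comb_step: "set_pmf (srw_step comb_adj v) = {w. comb_adj v w}"
  unfolding srw_step_def by (rule set_pmf_of_set[OF comb_neighbours_nonempty finite_comb_neighbours])

lemma finite_comb_law: "finite (set_pmf (comb_law n))"
  by (induction n) (auto simp: set_comb_step finite_comb_neighbours)

text \<open>
  Truncated subtraction gives \<open>0 - 1 = 0\<close>, so the same formula covers the \<open>x\<close>-axis: there the two
  horizontal neighbours keep the height \<open>0\<close>.
\<close>

lemma comb_step_height_mean:
  fixes g :: "nat \<Rightarrow> real"
  shows "measure_pmf.expectation (srw_step comb_adj v) (\<lambda>w. g (height w)) =
           (g (height v - 1) + g (height v + 1)) / 2"
proof -
  obtain x y where v: "v = (x, y)" by (cases v)
  have "measure_pmf.expectation (srw_step comb_adj v) (\<lambda>w. g (height w)) =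
          (\<Sum>w\<in>{w. comb_adj v w}. g (height w)) / card {w. comb_adj v w}"
    unfolding srw_step_def
    by (rule integral_pmf_of_set[OF comb_neighbours_nonempty finite_comb_neighbours])
  also have "\<dots> = (g (height v - 1) + g (height v + 1)) / 2"
  proof (cases y "0 :: int" rule: linorder_cases)
    case less
    then have "nat \<bar>y + 1\<bar> = nat \<bar>y\<bar> - 1" "nat \<bar>y - 1\<bar> = nat \<bar>y\<bar> + 1"
      by auto
    with less show ?thesis
      by (simp add: v comb_neighbours height_def del: abs_add_one_gt_zero)
  next
    case equal
    then show ?thesis
      by (simp add: v comb_neighbours height_def)
  next
    case greater
    then have "nat \<bar>y + 1\<bar> = nat \<bar>y\<bar> + 1" "nat \<bar>y - 1\<bar> = nat \<bar>y\<bar> - 1"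
      by auto
    with greater show ?thesis
      by (simp add: v comb_neighbours height_def)
  qed
  finally show ?thesis .
qed

lemma height_mean_0: "height_mean 0 g = g 0"
  by (simp add: height_mean_def height_def)

lemma height_mean_Suc:
  "height_mean (Suc n) g = height_mean n (\<lambda>k. (g (k - 1) + g (k + 1)) / 2)"
proof -
  let ?p = "comb_law n"
  have "height_mean (Suc n) g =
      (\<Sum>v\<in>set_pmf ?p. pmf ?p v *\<^sub>R
        measure_pmf.expectation (srw_step comb_adj v) (\<lambda>w. g (height w)))"
    unfolding height_mean_def srw_law.simps
    by (intro pmf_expectation_bind) (simp_all add: finite_comb_law set_comb_step finite_comb_neighbours)
  also have "\<dots> = height_mean n (\<lambda>k. (g (k - 1) + g (k + 1)) / 2)"
    unfolding height_mean_def comb_step_height_mean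
    by (intro integral_measure_pmf [symmetric]) (simp_all add: finite_comb_law)
  finally show ?thesis .
qed

lemma height_mean_add:
  "height_mean n (\<lambda>k. g k + h k) = height_mean n g + height_mean n h"
  by (simp add: height_mean_def integrable_measure_pmf_finite finite_comb_law)

lemma height_mean_divide: "height_mean n (\<lambda>k. g k / c) = height_mean n g / c"
  by (simp add: height_mean_def)

lemma choose_half_up: "n choose ((n + 1) div 2) = n choose (n div 2)"
proof -
  have "n - n div 2 = (n + 1) div 2" by linarith
  then show ?thesis
    using binomial_symmetric[of "n div 2" n] by simp
qed

text \<open>
  After \<open>n\<close> steps the simple random walk on the integers can be only at that one of \<open>k\<close> and
  \<open>- 1 - k\<close> that has the parity of \<open>n\<close>: at \<open>k\<close> after \<open>(n + k) / 2\<close> steps up, at \<open>- 1 - k\<close> after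
  \<open>(n + k + 1) / 2\<close> steps down. The lower index below is this number of steps in either case. The
  resulting probabilities satisfy the recurrence of the height: away from \<open>0\<close> it is Pascal's rule,
  and at \<open>0\<close> the symmetry of the binomial coefficients is used as well.
\<close>

lemma height_law:
  "height_mean n (indicator {k}) = real (n choose ((n + k + 1) div 2)) / 2 ^ n"
proof (induction n arbitrary: k)
  case 0
  show ?case
    by (cases k) (auto simp: height_mean_0 indicator_def)
next
  case (Suc n)
  show ?case
  proof (cases k)
    case 0
    have "(\<lambda>j. (indicator {k} (j - 1) + indicator {k} (j + 1)) / 2 :: real) =
            (\<lambda>j. (indicator {0} j + indicator {1} j) / 2)"
      by (auto simp: 0 indicator_def fun_eq_iff)
    then have "height_mean (Suc n) (indicator {k}) =
        (real (n choose ((n + 1) div 2)) + real (n choose ((n + 2) div 2))) / 2 ^ Suc n"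
      by (simp add: height_mean_Suc height_mean_add height_mean_divide Suc.IH add_divide_distrib)
    also have "n choose ((n + 1) div 2) = n choose (n div 2)"
      by (rule choose_half_up)
    finally show ?thesis
      by (simp add: 0)
  next
    case (Suc m)
    have "(\<lambda>j. (indicator {k} (j - 1) + indicator {k} (j + 1)) / 2 :: real) =
            (\<lambda>j. (indicator {m} j + indicator {m + 2} j) / 2)"
      by (auto simp: Suc indicator_def fun_eq_iff)
    then show ?thesis
      by (simp add: height_mean_Suc height_mean_add height_mean_divide Suc.IH add_divide_distrib Suc)
  qed
qed

text \<open>
  One step leaves the average height unchanged from \<open>k > 0\<close> and raises it by \<open>1/2\<close> from \<open>0\<close>.
\<close>

lemma mean_height_Suc:
  "height_mean (Suc n) real = height_mean n real + real (n choose (n div 2)) / 2 ^ Suc n"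
proof -
  have "(\<lambda>k. (real (k - 1) + real (k + 1)) / 2) = (\<lambda>k. real k + indicator {0} k / 2)"
    by (auto simp: fun_eq_iff indicator_def of_nat_diff field_simps)
  then show ?thesis
    by (simp add: height_mean_Suc height_mean_add height_mean_divide height_law choose_half_up [simplified])
qed

section \<open>Closed form of the mean height\<close>

text \<open>
  This is the probability that the simple random walk on the integers is back at \<open>0\<close> at time \<open>2 m\<close>.
\<close>

definition central_prob :: "nat \<Rightarrow> real" where
  "central_prob m = real (2 * m choose m) / 4 ^ m"

lemma central_prob_Suc:
  "central_prob (Suc m) = central_prob m * (2 * real m + 1) / (2 * real m + 2)"
proof -
  have "real (2 * Suc m choose Suc m) = fact (2 * m + 2) / (fact (m + 1) * fact (m + 1))"
    by (subst binomial_fact) simp_all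
  also have "fact (2 * m + 2) = (2 * (real m + 1)) * ((2 * real m + 1) * fact (2 * m))"
    by (simp add: algebra_simps)
  also have "fact (m + 1) = (real m + 1) * fact m"
    by (simp add: algebra_simps)
  also have "2 * (real m + 1) * ((2 * real m + 1) * fact (2 * m)) /
      ((real m + 1) * fact m * ((real m + 1) * fact m)) =
      2 * (2 * real m + 1) / (real m + 1) * (fact (2 * m) / (fact m * fact m))"
    by (simp add: divide_simps) (simp add: algebra_simps)
  also have "fact (2 * m) / (fact m * fact m) = real (2 * m choose m)"
    by (subst binomial_fact) simp_all
  finally show ?thesis
    unfolding central_prob_def
    by (simp add: divide_simps del: binomial_Suc_Suc) (simp add: algebra_simps del: binomial_Suc_Suc)
qed

lemma choose_half_odd:
  "real (2 * m + 1 choose m) / 2 ^ (2 * m + 1) = central_prob (Suc m)"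
proof -
  have "2 * Suc m choose Suc m = (2 * m + 1 choose m) + (2 * m + 1 choose Suc m)"
    by simp
  moreover have "(2 * m + 1 choose Suc m) = (2 * m + 1 choose m)"
    using binomial_symmetric[of m "2 * m + 1"] by simp
  ultimately show ?thesis
    by (simp add: central_prob_def power_mult)
qed

text \<open>
  The sum of the increments telescopes, because
  \<open>(2 m + 2) central_prob (m + 1) = (2 m + 1) central_prob m\<close> makes
  \<open>(2 m + 1/2) central_prob m\<close> grow by \<open>(central_prob m + central_prob (m + 1)) / 2\<close>, the growth of
  the mean height over two steps.
\<close>

lemma mean_height_closed_form:
  "height_mean (2 * m) real = (2 * real m + 1 / 2) * central_prob m - 1 / 2"
  "height_mean (2 * m + 1) real = (2 * real m + 1) * central_prob m - 1 / 2"
proof -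
  have odd: "height_mean (2 * m + 1) real = height_mean (2 * m) real + central_prob m / 2" for m
    using mean_height_Suc[of "2 * m"] by (simp add: central_prob_def power_mult)
  show even: "height_mean (2 * m) real = (2 * real m + 1 / 2) * central_prob m - 1 / 2"
  proof (induction m)
    case 0
    show ?case by (simp add: height_mean_0 central_prob_def)
  next
    case (Suc m)
    have recurrence: "2 * (real m * central_prob (Suc m)) + 2 * central_prob (Suc m) =
        2 * (real m * central_prob m) + central_prob m"
    proof -
      have "2 * real m + 2 \<noteq> 0" by linarith
      then have "central_prob (Suc m) * (2 * real m + 2) = central_prob m * (2 * real m + 1)"
        by (simp add: central_prob_Suc)
      then show ?thesis
        by (simp add: algebra_simps)
    qed
    have "height_mean (2 * Suc m) real = height_mean (2 * m + 1) real + central_prob (Suc m) / 2"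
      using mean_height_Suc[of "2 * m + 1"] choose_half_odd[of m] by simp
    then show ?case
      using odd[of m] Suc recurrence by (simp add: algebra_simps)
  qed
  show "height_mean (2 * m + 1) real = (2 * real m + 1) * central_prob m - 1 / 2"
    using odd[of m] even by (simp add: field_simps)
qed

section \<open>Asymptotics\<close>

text \<open>
  The factors \<open>(2 k - 1) / (2 k)\<close> of \<open>central_prob m\<close>, squared, rearrange to the inverse of the
  partial Wallis product up to the factor \<open>2 m + 1\<close>.
\<close>

lemma central_prob_asymptotics:
  "(\<lambda>m. sqrt (2 * real m + 1) * central_prob m) \<longlonglongrightarrow> sqrt (2 / pi)"
proof -
  have eq: "(\<Prod>k=1..m. (4 * real k ^ 2) / (4 * real k ^ 2 - 1)) =
               1 / ((2 * real m + 1) * central_prob m ^ 2)" for m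
  proof (induction m)
    case 0
    show ?case by (simp add: central_prob_def)
  next
    case (Suc m)
    have c: "central_prob m > 0" by (simp add: central_prob_def)
    have "4 * real (Suc m) ^ 2 - 1 = (2 * real m + 1) * (2 * real m + 3)"
      by (simp add: power2_eq_square algebra_simps)
    moreover have "4 * real (Suc m) ^ 2 = (2 * real m + 2) ^ 2"
      by (simp add: power2_eq_square algebra_simps)
    ultimately have "(\<Prod>k=1..Suc m. (4 * real k ^ 2) / (4 * real k ^ 2 - 1)) =
        1 / ((2 * real m + 1) * central_prob m ^ 2) *
          ((2 * real m + 2) ^ 2 / ((2 * real m + 1) * (2 * real m + 3)))"
      by (simp only: prod.cl_ivl_Suc Suc.IH) simp
    also have "\<dots> = 1 / ((2 * real m + 3) *
                       (central_prob m * (2 * real m + 1) / (2 * real m + 2)) ^ 2)"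
      using c by (simp add: power_divide power_mult_distrib power2_eq_square)
    finally show ?case
      by (simp add: central_prob_Suc add.commute)
  qed
  have "(\<lambda>m. sqrt (inverse (1 / ((2 * real m + 1) * central_prob m ^ 2))))
          \<longlonglongrightarrow> sqrt (inverse (pi / 2))"
    by (intro tendsto_real_sqrt tendsto_inverse wallis [unfolded eq]) simp
  moreover have "sqrt (inverse (1 / ((2 * real m + 1) * central_prob m ^ 2))) =
      sqrt (2 * real m + 1) * central_prob m" for m
    by (simp add: real_sqrt_mult central_prob_def)
  ultimately show ?thesis
    by (simp add: inverse_eq_divide)
qed

lemma mean_height_limit: "(\<lambda>n. height_mean n real / sqrt (real n)) \<longlonglongrightarrow> sqrt (2 / pi)"
proof (rule limseq_even_odd)
  have ratio: "(\<lambda>m. (2 * real m + 1 / 2) / (sqrt (2 * real m) * sqrt (2 * real m + 1))) \<longlonglongrightarrow> 1"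
  proof -
    have "(\<lambda>m. ((2 * real m + 1 / 2) ^ 2) / (2 * real m * (2 * real m + 1))) \<longlonglongrightarrow> 1"
      by real_asymp
    then have "(\<lambda>m. sqrt (((2 * real m + 1 / 2) ^ 2) / (2 * real m * (2 * real m + 1)))) \<longlonglongrightarrow> sqrt 1"
      by (rule tendsto_real_sqrt)
    then show ?thesis
      by (simp add: real_sqrt_divide real_sqrt_mult)
  qed
  have "(\<lambda>m. (2 * real m + 1 / 2) / (sqrt (2 * real m) * sqrt (2 * real m + 1)) *
               (sqrt (2 * real m + 1) * central_prob m) - 1 / 2 / sqrt (2 * real m))
          \<longlonglongrightarrow> 1 * sqrt (2 / pi) - 0"
    by (intro tendsto_diff tendsto_mult ratio central_prob_asymptotics) real_asymp
  moreover have "(2 * real m + 1 / 2) / (sqrt (2 * real m) * sqrt (2 * real m + 1)) *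
      (sqrt (2 * real m + 1) * central_prob m) - 1 / 2 / sqrt (2 * real m) =
      height_mean (2 * m) real / sqrt (real (2 * m))" for m
    by (simp add: mean_height_closed_form diff_divide_distrib)
  ultimately show "(\<lambda>m. height_mean (2 * m) real / sqrt (real (2 * m))) \<longlonglongrightarrow> sqrt (2 / pi)"
    by simp
next
  have "(\<lambda>m. sqrt (2 * real m + 1) * central_prob m - 1 / 2 / sqrt (2 * real m + 1))
          \<longlonglongrightarrow> sqrt (2 / pi) - 0"
    by (intro tendsto_diff central_prob_asymptotics) real_asymp
  moreover have "sqrt (2 * real m + 1) * central_prob m - 1 / 2 / sqrt (2 * real m + 1) =
      height_mean (2 * m + 1) real / sqrt (real (2 * m + 1))" for m
  proof -
    have "height_mean (2 * m + 1) real / sqrt (real (2 * m + 1)) =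
        (2 * real m + 1) / sqrt (2 * real m + 1) * central_prob m - 1 / 2 / sqrt (2 * real m + 1)"
      by (subst mean_height_closed_form) (simp add: diff_divide_distrib add.commute)
    also have "(2 * real m + 1) / sqrt (2 * real m + 1) = sqrt (2 * real m + 1)"
      by (simp add: real_div_sqrt)
    finally show ?thesis ..
  qed
  ultimately show "(\<lambda>m. height_mean (2 * m + 1) real / sqrt (real (2 * m + 1))) \<longlonglongrightarrow> sqrt (2 / pi)"
    by simp
qed

theorem theorem3p2:
  fixes M :: "'a measure" and S :: "nat \<Rightarrow> 'a \<Rightarrow> int \<times> int"
  assumes "simple_random_walk comb_adj (0, 0) M S"
  shows "(\<lambda>n. prob_space.expectation M (\<lambda>\<omega>. \<bar>real_of_int (snd (S n \<omega>))\<bar>))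
           \<sim>[sequentially] (\<lambda>n. sqrt (2 / pi) * real n powr (1 / 2))"
proof -
  have "prob_space.expectation M (\<lambda>\<omega>. \<bar>real_of_int (snd (S n \<omega>))\<bar>) = height_mean n real" for n
    using simple_random_walk_expectation[OF assms, of "\<lambda>v. real (height v)" n]
    by (simp add: height_mean_def height_def)
  moreover have "(\<lambda>n. height_mean n real / real n powr (1 / 2)) \<longlonglongrightarrow> sqrt (2 / pi)"
    using mean_height_limit by (simp add: powr_half_sqrt)
  ultimately show ?thesis
    by (intro asymp_equivI'_const) simp_all
qed

end
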